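(* For every instance $\mathcal{I}=([n],[m],(v_i)_{i\in[n]})$ (with valuations normalized so that $\mathrm{MMS}_i=1$), there exist choices of the parameters $c$ and $k$, and failure probabilities $q_i$, $i\in[n]$, such that: (1) for every agent $i\in[n]$ with a submodular valuation function, following the safe strategy $\mathcal{S}_i$ in the Single-or-Sample algorithm guarantees agent $i$ an allocation of value at least $\frac1{24}\mathrm{MMS}_i$ with probability at least $1-q_i$, regardless of the actions of the other agents; (2) $\sum_{i\in[n]}q_i\le 0.577$.
   Context: Setting: $n$ agents arrive in order $1,\dots,n$; agent $i$ has a monotone valuation $v_i:2^{[m]}\to\mathbb{R}_+$ over $m$ indivisible goods, and $\mathrm{MMS}_i=\max_{(P_1,\dots,P_n)}\min_\ell v_i(P_\ell)$ over partitions of $[m]$ into $n$ bundles. Single-or-Sample algorithm with parameter $k$: set $R_1=[m]$, $t=0$. For $i=1,\dots,n$: agent $i$ observes the remaining set $R_i$ and chooses one of two actions. (Special round) She selects an item $e\in R_i$, receives $\{e\}$; set $R_{i+1}=R_i\setminus\{e\}$ and $t\leftarrow t+1$. (Non-special round) Set $G=R_i$, $j=1$. While $|G|\ge k(n-t)$: agent $i$ specifies a bucket $B_{ij}\subseteq G$ with $|B_{ij}|=k(n-t)$ (possibly depending on earlier draws); an item $e_{ij}$ is picked uniformly at random from $B_{ij}$; set $G\leftarrow G\setminus B_{ij}$, $j\leftarrow j+1$. Agent $i$ receives $A_i=\bigcup_j\{e_{ij}\}$ and $R_{i+1}=R_i\setminus A_i$. Safe strategy $\mathcal{S}_i$ with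 parameter $c$, with $\tau=\frac{1}{ck}$: if $R_i$ contains an item $e$ with $v_i(\{e\})\ge\tau$, agent $i$ chooses a special round and selects an item of maximum singleton value in $R_i$. Otherwise she chooses the non-special round, and in step $j$ takes $B_{ij}$ to be the $k(n-t)$ items $e$ of $G$ with the largest marginal values $v_i(A_i^{j-1}\cup\{e\})-v_i(A_i^{j-1})$, where $A_i^{j-1}=\{e_{ij'}:j'<j\}$. The other agents may choose special or non-special rounds, items and buckets as arbitrary functions of the history so far. *)

theory Defs
  imports "HOL-Probability.Probability"
begin

text \<open>
  The goods are \<open>{1..m}\<close> and the agents are \<open>{1..n}\<close>, in order of arrival.
\<close>

definition valuation :: "nat \<Rightarrow> (nat set \<Rightarrow> real) \<Rightarrow> bool" where
  "valuation m v \<longleftrightarrow> (\<forall>S\<subseteq>{1..m}. 0 \<le> v S) \<and> mono_on (Pow {1..m}) v"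

definition submodular_on :: "nat set \<Rightarrow> (nat set \<Rightarrow> real) \<Rightarrow> bool" where
  "submodular_on M v \<longleftrightarrow> (\<forall>A\<subseteq>M. \<forall>B\<subseteq>M. v (A \<union> B) + v (A \<inter> B) \<le> v A + v B)"

definition partitions :: "nat \<Rightarrow> nat \<Rightarrow> (nat \<Rightarrow> nat set) set" where
  \<comment> \<open>bundles may be empty\<close>
  "partitions n m = {P \<in> {1..n} \<rightarrow>\<^sub>E Pow {1..m}.
     disjoint_family_on P {1..n} \<and> (\<Union>l\<in>{1..n}. P l) = {1..m}}"

definition MMS :: "nat \<Rightarrow> nat \<Rightarrow> (nat set \<Rightarrow> real) \<Rightarrow> real" where
  "MMS n m v = (MAX P\<in>partitions n m. MIN l\<in>{1..n}. v (P l))"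


text \<open>
  A (completed) round is either special, with the selected item, or non-special, with
  the list of pairs \<open>(B, e)\<close> of a specified bucket and the item drawn from it, in
  chronological order. A history is the list of the rounds of the agents so far.
\<close>

type_synonym draws = "(nat set \<times> nat) list"

datatype outcome = Special nat | NonSpecial draws

type_synonym history = "outcome list"

definition drawn :: "draws \<Rightarrow> nat set" where
  "drawn ds = snd ` set ds"

fun received :: "outcome \<Rightarrow> nat set" where
  "received (Special e) = {e}"
| "received (NonSpecial ds) = drawn ds"

definition remaining :: "nat \<Rightarrow> history \<Rightarrow> nat set" where
  "remaining m h = {1..m} - (\<Union>r\<in>set h. received r)"

definition num_special :: "history \<Rightarrow> nat" where
  "num_special h = length (filter (\<lambda>r. \<exists>e. r = Special e) h)"

definition bucket_size :: "nat \<Rightarrow> nat \<Rightarrow> history \<Rightarrow> nat" where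
  \<comment> \<open>the subtraction does not truncate when \<open>length h \<le> n\<close>\<close>
  "bucket_size n k h = k * (n - num_special h)"

definition unbucketed :: "nat \<Rightarrow> history \<Rightarrow> draws \<Rightarrow> nat set" where
  \<comment> \<open>the set \<open>G\<close> of the algorithm, after the draws \<open>ds\<close> of the current round\<close>
  "unbucketed m h ds = remaining m h - (\<Union>B\<in>fst ` set ds. B)"

text \<open>
  \<open>choice \<sigma> h\<close> is \<open>Some e\<close> for a special round selecting \<open>e\<close>, and \<open>None\<close> for a
  non-special round; \<open>bucket \<sigma> h ds\<close> is the next bucket when the current agent has
  already made the draws \<open>ds\<close> in her non-special round. So a strategy depends on the
  complete public history, including all earlier buckets and draws.
\<close>

datatype strategy = Strategy
  (choice: "history \<Rightarrow> nat option")
  (bucket: "history \<Rightarrow> draws \<Rightarrow> nat set")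

text \<open>
  The following two predicates constrain a strategy at all histories. Histories that
  cannot occur are harmless: the behaviour there can be changed to meet the
  constraints without affecting any run.
\<close>

definition legal :: "nat \<Rightarrow> nat \<Rightarrow> nat \<Rightarrow> strategy \<Rightarrow> bool" where
  "legal n m k \<sigma> \<longleftrightarrow> (\<forall>h.
     case choice \<sigma> h of
       Some e \<Rightarrow> e \<in> remaining m h
     | None \<Rightarrow> (\<forall>ds. bucket_size n k h \<le> card (unbucketed m h ds) \<longrightarrow>
         bucket \<sigma> h ds \<subseteq> unbucketed m h ds \<and> card (bucket \<sigma> h ds) = bucket_size n k h))"

definition marginal :: "(nat set \<Rightarrow> real) \<Rightarrow> nat set \<Rightarrow> nat \<Rightarrow> real" where
  "marginal v A e = v (A \<union> {e}) - v A"

definition top_items :: "(nat \<Rightarrow> real) \<Rightarrow> nat \<Rightarrow> nat set \<Rightarrow> nat set \<Rightarrow> bool" where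
  "top_items w s G B \<longleftrightarrow> B \<subseteq> G \<and> card B = s \<and> (\<forall>e\<in>B. \<forall>e'\<in>G - B. w e' \<le> w e)"

text \<open>
  Being a safe strategy is a predicate rather than a specific strategy because ties may
  be broken arbitrarily, both in the special and in the non-special rounds.
\<close>

definition safe :: "nat \<Rightarrow> nat \<Rightarrow> nat \<Rightarrow> real \<Rightarrow> (nat set \<Rightarrow> real) \<Rightarrow> strategy \<Rightarrow> bool" where
  "safe n m k c v \<sigma> \<longleftrightarrow> (\<forall>h.
     if \<exists>e\<in>remaining m h. v {e} \<ge> 1 / (c * real k)
     then \<exists>e\<in>remaining m h. choice \<sigma> h = Some e \<and> (\<forall>e'\<in>remaining m h. v {e'} \<le> v {e})
     else choice \<sigma> h = None \<and>
       (\<forall>ds. bucket_size n k h \<le> card (unbucketed m h ds) \<longrightarrow>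
          top_items (marginal v (drawn ds)) (bucket_size n k h)
            (unbucketed m h ds) (bucket \<sigma> h ds)))"


text \<open>
  The while loop of a non-special round with bucket size \<open>s\<close> and bucket rule \<open>\<beta>\<close>.
  The guard contains more than \<open>s \<le> card G\<close> only to make the recursion total; for
  legal and for safe strategies and \<open>0 < s\<close> the additional conditions are implied.
\<close>

function sample_loop :: "(draws \<Rightarrow> nat set) \<Rightarrow> nat \<Rightarrow> nat set \<Rightarrow> draws \<Rightarrow> draws pmf" where
  "sample_loop \<beta> s G ds =
     (if s \<le> card G \<and> 0 < s \<and> \<beta> ds \<subseteq> G \<and> card (\<beta> ds) = s
      then do {
        e \<leftarrow> pmf_of_set (\<beta> ds);
        sample_loop \<beta> s (G - \<beta> ds) (ds @ [(\<beta> ds, e)])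
      }
      else return_pmf ds)"
  by pat_completeness auto

termination sample_loop
proof (relation "Wellfounded.measure (\<lambda>(\<beta>, s, G, ds). card G)", goal_cases)
  case 1
  show ?case by simp
next
  case (2 \<beta> s G ds e)
  then have "finite G" "\<beta> ds \<noteq> {}"
    by (auto intro: card_ge_0_finite)
  then have "card (G - \<beta> ds) < card G"
    using 2 by (intro psubset_card_mono) auto
  then show ?case by simp
qed

declare sample_loop.simps [simp del]

definition play :: "nat \<Rightarrow> nat \<Rightarrow> nat \<Rightarrow> strategy \<Rightarrow> history \<Rightarrow> outcome pmf" where
  "play n m k \<sigma> h =
     (case choice \<sigma> h of
        Some e \<Rightarrow> return_pmf (Special e)
      | None \<Rightarrow> map_pmf NonSpecial
          (sample_loop (bucket \<sigma> h) (bucket_size n k h) (remaining m h) []))"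

text \<open>The distribution of the history after the first \<open>i\<close> agents have acted.\<close>

fun run :: "nat \<Rightarrow> nat \<Rightarrow> nat \<Rightarrow> (nat \<Rightarrow> strategy) \<Rightarrow> nat \<Rightarrow> history pmf" where
  "run n m k \<sigma> 0 = return_pmf []"
| "run n m k \<sigma> (Suc i) = do {
     h \<leftarrow> run n m k \<sigma> i;
     r \<leftarrow> play n m k (\<sigma> (Suc i)) h;
     return_pmf (h @ [r])
   }"

definition single_or_sample :: "nat \<Rightarrow> nat \<Rightarrow> nat \<Rightarrow> (nat \<Rightarrow> strategy) \<Rightarrow> history pmf" where
  "single_or_sample n m k \<sigma> = run n m k \<sigma> n"

definition allocation :: "history \<Rightarrow> nat \<Rightarrow> nat set" where
  "allocation h i = received (h ! (i - 1))"

end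

theory Submission
  imports Defs
begin

text \<open>
  Take \<open>k = 4\<close> and \<open>c = 6\<close>. By submodularity every MMS bundle carries nonnegative item
  weights of total 1 that bound the value of its subsets from below. Let \<open>W\<close> be the weight
  still available in \<open>n - t\<close> bundles not hit by special rounds. A non-special round
  removes expected weight at most \<open>W / (k (n - t)) \<le> 1 / k\<close>, draw by draw in
  pieces of size at most 1, and a special round does not increase the deficit
  \<open>(n - t) - W\<close>. Hence \<open>5 powr ((n - t) - W) * exp (- N)\<close>, with \<open>N\<close> the number of
  non-special rounds, is a supermartingale starting at 1.

  If \<open>W \<ge> 3/8 (n - t)\<close> when a safe agent samples, she gets at least \<open>1/24\<close> with certainty:
  as the buckets are sorted by marginal values, the gain in each step bounds every marginal
  value in the next bucket, so only the first bucket, whose items are worth less than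
  \<open>1/24\<close>, is not paid for. Otherwise the supermartingale of agent \<open>i\<close> is at
  least \<open>5 powr (5/8 (n + 1 - i))\<close>, because \<open>exp 1 \<le> 5 powr (5/8)\<close>. By Markov's inequality
  this bounds the failure probability, and the resulting geometric series is at
  most \<open>1 / (5 powr (5/8) - 1) \<le> 0.577\<close>.
\<close>

section \<open>Marginal values under submodularity\<close>

lemma mono_valuation:
  assumes "valuation m v" "A \<subseteq> B" "B \<subseteq> {1..m}"
  shows "v A \<le> v B"
  using assms unfolding valuation_def mono_on_def by blast

lemma marginal_nonneg:
  assumes "valuation m v" "A \<subseteq> {1..m}" "e \<in> {1..m}"
  shows "0 \<le> marginal v A e"
  using mono_valuation[of m v A "A \<union> {e}"] assms by (auto simp: marginal_def)

text \<open>Apply the lattice form of submodularity to \<open>A \<union> {e}\<close> and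
  \<open>B\<close>: for \<open>e \<notin> B\<close> their intersection is \<open>A\<close>. For
  \<open>e \<in> B\<close> the left side is 0.\<close>

lemma marginal_antimono:
  assumes "valuation m v" "submodular_on {1..m} v" "A \<subseteq> B" "B \<subseteq> {1..m}" "e \<in> {1..m}"
  shows "marginal v B e \<le> marginal v A e"
proof (cases "e \<in> B")
  case True
  then have "B \<union> {e} = B" by auto
  then show ?thesis
    using marginal_nonneg[of m v A e] assms by (simp add: marginal_def)
next
  case False
  have "v ((A \<union> {e}) \<union> B) + v ((A \<union> {e}) \<inter> B) \<le> v (A \<union> {e}) + v B"
    using assms unfolding submodular_on_def
    by (meson Un_subset_iff empty_subsetI insert_subset subset_trans)
  moreover have "(A \<union> {e}) \<union> B = B \<union> {e}" "(A \<union> {e}) \<inter> B = A"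
    using False assms(3) by auto
  ultimately show ?thesis by (simp add: marginal_def)
qed

lemma gain_le_sum_marginal:
  assumes "valuation m v" "submodular_on {1..m} v" "A \<subseteq> {1..m}" "S \<subseteq> {1..m}"
  shows "v (A \<union> S) - v A \<le> (\<Sum>e\<in>S. marginal v A e)"
proof -
  have "finite S" using assms(4) finite_subset by blast
  then show ?thesis using assms(4)
  proof (induction S)
    case empty
    then show ?case by simp
  next
    case (insert x S)
    have "marginal v (A \<union> S) x \<le> marginal v A x"
      using insert.prems assms by (intro marginal_antimono[of m]) auto
    then have "v (A \<union> insert x S) - v (A \<union> S) \<le> marginal v A x"
      by (simp add: marginal_def)
    then show ?case using insert by simp
  qed
qed

section \<open>Additive lower bounds for the valuation on the MMS bundles\<close>

text \<open>Build \<open>T\<close> item by item and give each item its marginal value on insertion.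
  The total telescopes; within a subset \<open>S\<close> each item has fewer predecessors, so its
  marginal there is no smaller than its weight.\<close>

lemma greedy_weights:
  assumes "valuation m v" "submodular_on {1..m} v" "T \<subseteq> {1..m}"
  shows "\<exists>a. (\<forall>e\<in>T. 0 \<le> a e) \<and> sum a T = v T - v {} \<and>
           (\<forall>S\<subseteq>T. v {} + sum a S \<le> (v S :: real))"
proof -
  have "finite T" using assms(3) finite_subset by blast
  then show ?thesis using assms(3)
  proof (induction T)
    case empty
    then show ?case by auto
  next
    case (insert x T)
    then obtain a where a: "\<forall>e\<in>T. 0 \<le> a e" "sum a T = v T - v {}"
      "\<And>S. S \<subseteq> T \<Longrightarrow> v {} + sum a S \<le> v S" by auto
    define b where "b = a(x := marginal v T x)"
    have sum_b: "sum b S = sum a S" if "S \<subseteq> T" for S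
      using that insert.hyps by (intro sum.cong) (auto simp: b_def)
    have "0 \<le> b e" if "e \<in> insert x T" for e
      using that a(1) insert.prems marginal_nonneg[OF assms(1), of T x]
      by (auto simp: b_def)
    moreover have "sum b (insert x T) = v (insert x T) - v {}"
      using insert.hyps a(2) by (simp add: sum_b) (simp add: b_def marginal_def)
    moreover have "v {} + sum b S \<le> v S" if S: "S \<subseteq> insert x T" for S
    proof (cases "x \<in> S")
      case True
      then have S': "S - {x} \<subseteq> T" "S = insert x (S - {x})" using S by auto
      have fin: "finite (S - {x})" using S'(1) insert.hyps finite_subset by blast
      have "sum b S = marginal v T x + sum a (S - {x})"
        by (subst S'(2), subst sum.insert[OF fin]) (auto simp: sum_b[OF S'(1)] b_def)
      moreover have "marginal v T x \<le> marginal v (S - {x}) x"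
        using insert.prems S' by (intro marginal_antimono[OF assms(1,2)]) auto
      moreover have "v S = v (S - {x}) + marginal v (S - {x}) x"
        using S'(2) by (simp add: marginal_def insert_absorb True)
      ultimately show ?thesis using a(3)[OF S'(1)] by simp
    next
      case False
      then have "S \<subseteq> T" using S by auto
      then show ?thesis using a(3) sum_b by simp
    qed
    ultimately show ?case by blast
  qed
qed

text \<open>Rescaling is needed because \<open>v {}\<close> may be positive. If \<open>p\<close> in
  [0,1] is the rescaled weight of \<open>S\<close>, the greedy bound reads
  \<open>v S \<ge> p * v T + (1 - p) * v {}\<close>, which is at least \<open>p\<close>.\<close>

lemma normalized_weights:
  assumes "valuation m v" "submodular_on {1..m} v" "T \<subseteq> {1..m}"
    and "v {} < 1" "1 \<le> v T"
  shows "\<exists>a. (\<forall>e\<in>T. 0 \<le> a e) \<and> sum a T = 1 \<and> (\<forall>S\<subseteq>T. sum a S \<le> (v S :: real))"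
proof -
  obtain a where a: "\<forall>e\<in>T. 0 \<le> a e" "sum a T = v T - v {}"
    "\<And>S. S \<subseteq> T \<Longrightarrow> v {} + sum a S \<le> v S"
    using greedy_weights[OF assms(1-3)] by blast
  have z: "0 \<le> v {}" using assms(1) by (auto simp: valuation_def)
  have pos: "0 < v T - v {}" using assms by simp
  have finT: "finite T" using assms(3) finite_subset by blast
  define b where "b = (\<lambda>e. a e / (v T - v {}))"
  have sum_b: "sum b S = sum a S / (v T - v {})" for S
    by (simp add: b_def sum_divide_distrib)
  have "sum b S \<le> v S" if S: "S \<subseteq> T" for S
  proof -
    have "sum a S \<le> sum a T" using S a(1) finT by (intro sum_mono2) auto
    then have le1: "sum b S \<le> 1" using a(2) pos by (simp add: sum_b)
    have "sum a S = sum b S * (v T - v {})" using pos by (simp add: sum_b)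
    moreover have "0 \<le> sum b S"
      using S a(1) pos by (auto simp: b_def intro!: sum_nonneg)
    then have "sum b S \<le> sum b S * v T" using assms(5) by (simp add: mult_le_cancel_left1)
    moreover have "sum b S * v {} \<le> v {}" using le1 z by (simp add: mult_left_le_one_le mult_le_cancel_right2)
    ultimately have "sum b S \<le> v {} + sum a S" by (simp add: algebra_simps)
    then show ?thesis using a(3)[OF S] by simp
  qed
  moreover have "0 \<le> b e" if "e \<in> T" for e using that a(1) pos by (simp add: b_def)
  moreover have "sum b T = 1" using a(2) pos by (simp add: sum_b)
  ultimately show ?thesis by blast
qed

lemma MMS_witness:
  assumes "1 \<le> n"
  obtains P where "P \<in> partitions n m" "\<And>l. l \<in> {1..n} \<Longrightarrow> MMS n m v \<le> v (P l)"
proof -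
  have "partitions n m \<subseteq> {1..n} \<rightarrow>\<^sub>E Pow {1..m}" by (auto simp: partitions_def)
  then have fin: "finite (partitions n m)"
    by (rule finite_subset) (auto intro: finite_PiE)
  \<comment> \<open>Putting all goods into bundle 1 shows that the maximum is over a nonempty
    set.\<close>
  have "(\<lambda>l\<in>{1..n}. if l = 1 then {1..m} else {}) \<in> partitions n m"
    using assms by (auto simp: partitions_def disjoint_family_on_def split: if_splits)
  then have "MMS n m v \<in> (\<lambda>P. MIN l\<in>{1..n}. v (P l)) ` partitions n m"
    unfolding MMS_def using fin by (intro Max_in) auto
  then obtain P where P: "P \<in> partitions n m" "MMS n m v = (MIN l\<in>{1..n}. v (P l))" by auto
  show ?thesis by (rule that[OF P(1)]) (simp add: P(2))
qed

lemma bundle_weights: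
  assumes "valuation m v" "submodular_on {1..m} v" "P \<in> partitions n m"
    and "v {} < 1" "\<And>l. l \<in> {1..n} \<Longrightarrow> 1 \<le> v (P l)"
  obtains w :: "nat \<Rightarrow> real" where "\<And>l e. l \<in> {1..n} \<Longrightarrow> e \<in> P l \<Longrightarrow> 0 \<le> w e"
    "\<And>l. l \<in> {1..n} \<Longrightarrow> sum w (P l) = 1"
    "\<And>l S. l \<in> {1..n} \<Longrightarrow> S \<subseteq> P l \<Longrightarrow> sum w S \<le> v S"
proof -
  have "\<forall>l\<in>{1..n}. \<exists>a. (\<forall>e\<in>P l. 0 \<le> a e) \<and> sum a (P l) = 1 \<and> (\<forall>S\<subseteq>P l. sum a S \<le> v S)"
    using assms by (intro ballI normalized_weights[of m]) (auto simp: partitions_def)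
  then obtain a where a: "\<And>l. l \<in> {1..n} \<Longrightarrow>
      (\<forall>e\<in>P l. 0 \<le> a l e) \<and> sum (a l) (P l) = 1 \<and> (\<forall>S\<subseteq>P l. sum (a l) S \<le> v S)"
    by metis
  \<comment> \<open>Disjointness lets the weightings of the single bundles be glued into one
    function, unspecified outside the bundles.\<close>
  define w where "w e = a (THE l. l \<in> {1..n} \<and> e \<in> P l) e" for e
  have w: "w e = a l e" if "l \<in> {1..n}" "e \<in> P l" for l e
  proof -
    have "(THE l. l \<in> {1..n} \<and> e \<in> P l) = l"
      using that assms(3)
      by (intro the_equality) (auto simp: partitions_def dest: disjoint_family_onD)
    then show ?thesis by (simp add: w_def)
  qed
  have sum_w: "sum w S = sum (a l) S" if "l \<in> {1..n}" "S \<subseteq> P l" for l S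
    using that w by (intro sum.cong) auto
  show ?thesis
    by (rule that[of w]) (use a w sum_w in auto)
qed

section \<open>The value that a safe sampling round yields with certainty\<close>

text \<open>In the invariant, the budget \<open>s * (\<tau> + v A)\<close> covers the marginals of
  all items bucketed so far and a reserve \<open>s * b\<close> for one more bucket, where
  \<open>b\<close> bounds the marginals of unbucketed items. The next bucket uses up the reserve;
  the gain of the drawn item raises the budget and funds the new reserve.\<close>

lemma sample_loop_safe:
  assumes val: "valuation m v" and sub: "submodular_on {1..m} v" and "R \<subseteq> {1..m}"
    and top: "\<And>ds. s \<le> card (R - (\<Union>B\<in>fst ` set ds. B)) \<Longrightarrow>
      top_items (marginal v (drawn ds)) s (R - (\<Union>B\<in>fst ` set ds. B)) (\<beta> ds)"
    and "0 < s" "G = R - (\<Union>B\<in>fst ` set ds. B)" "drawn ds \<subseteq> {1..m}"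
    and "0 \<le> b" "\<And>e. e \<in> G \<Longrightarrow> marginal v (drawn ds) e \<le> b"
    and "(\<Sum>e\<in>R - G. marginal v (drawn ds) e) + real s * b \<le> real s * (\<tau> + v (drawn ds))"
    and "ds' \<in> set_pmf (sample_loop \<beta> s G ds)"
  shows "drawn ds' \<subseteq> {1..m} \<and>
    (\<Sum>e\<in>R. marginal v (drawn ds') e) \<le> real s * (\<tau> + v (drawn ds'))"
  using assms(6-)
proof (induction "card G" arbitrary: G ds b rule: less_induct)
  \<comment> \<open>\<open>b\<close> is the gain of the previous step, or \<open>\<tau>\<close> initially\<close>
  case less
  let ?U = "\<lambda>ds. R - (\<Union>B\<in>fst ` set ds. B)"
  have finR: "finite R" using assms(3) finite_subset by blast
  have GR: "G \<subseteq> R" and finG: "finite G" using less.prems(1) finR by (auto intro: finite_subset)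
  have sumR: "sum f R = sum f (R - G) + sum f G" for f :: "nat \<Rightarrow> real"
    using GR finR by (metis add.commute sum.subset_diff)
  show ?case
  proof (cases "s \<le> card G")
    case False
    then have "ds' = ds" using less.prems(6) by (subst (asm) sample_loop.simps) auto
    \<comment> \<open>Fewer than \<open>s\<close> items are left over, so the reserve pays for
      them.\<close>
    have "(\<Sum>e\<in>G. marginal v (drawn ds) e) \<le> real (card G) * b"
      using less.prems(4) by (rule sum_bounded_above)
    also have "\<dots> \<le> real s * b" using False less.prems(3) by (intro mult_right_mono) auto
    finally show ?thesis
      using less.prems(2,5) by (simp add: \<open>ds' = ds\<close> sumR)
  next
    case True
    let ?B = "\<beta> ds"
    have B: "?B \<subseteq> G" "card ?B = s"
      and B_top: "\<And>e e'. e \<in> ?B \<Longrightarrow> e' \<in> G - ?B \<Longrightarrow>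
        marginal v (drawn ds) e' \<le> marginal v (drawn ds) e"
      using top[of ds] True less.prems(1) by (auto simp: top_items_def)
    have finB: "finite ?B" "?B \<noteq> {}" using B finG \<open>0 < s\<close> by (auto intro: finite_subset)
    have "ds' \<in> set_pmf (pmf_of_set ?B \<bind> (\<lambda>e. sample_loop \<beta> s (G - ?B) (ds @ [(?B, e)])))"
      using less.prems(6) True B \<open>0 < s\<close> by (subst (asm) sample_loop.simps) simp
    then obtain e where e: "e \<in> ?B" "ds' \<in> set_pmf (sample_loop \<beta> s (G - ?B) (ds @ [(?B, e)]))"
      using finB by auto
    let ?A = "drawn ds" and ?A' = "drawn (ds @ [(?B, e)])"
    have A': "?A' = ?A \<union> {e}" by (auto simp: drawn_def)
    have eM: "e \<in> {1..m}" using e(1) B GR assms(3) by blast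
    have A'M: "?A' \<subseteq> {1..m}" using A' eM less.prems(2) by auto
    have anti: "marginal v ?A' x \<le> marginal v ?A x" if "x \<in> R" for x
      using that assms(3) A'M A' by (intro marginal_antimono[OF val sub]) auto
    have vA': "v ?A' = v ?A + marginal v ?A e" by (simp add: A' marginal_def)
    have card_less: "card (G - ?B) < card G"
      using finG finB B(1) by (intro psubset_card_mono) auto
    show ?thesis
    proof (rule less.hyps[OF card_less, where b = "marginal v ?A e"])
      show "G - ?B = ?U (ds @ [(?B, e)])" using less.prems(1) by auto
      show "?A' \<subseteq> {1..m}" by (rule A'M)
      show "0 \<le> marginal v ?A e" using marginal_nonneg[OF val less.prems(2) eM] .
      \<comment> \<open>The drawn item comes from a top bucket, so its gain dominates the marginal
        of every item left.\<close>
      show "marginal v ?A' x \<le> marginal v ?A e" if "x \<in> G - ?B" for x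
        using anti[of x] B_top[OF e(1) that] that GR by force
      have split: "R - (G - ?B) = (R - G) \<union> ?B" "(R - G) \<inter> ?B = {}" using GR B(1) by auto
      have "(\<Sum>x\<in>R - (G - ?B). marginal v ?A' x) \<le> (\<Sum>x\<in>R - (G - ?B). marginal v ?A x)"
        using anti by (intro sum_mono) auto
      also have "\<dots> = (\<Sum>x\<in>R - G. marginal v ?A x) + (\<Sum>x\<in>?B. marginal v ?A x)"
        unfolding split(1) using finR finB split(2) by (intro sum.union_disjoint) auto
      also have "(\<Sum>x\<in>?B. marginal v ?A x) \<le> real s * b"
        using sum_bounded_above[of ?B "marginal v ?A" b] less.prems(4) B by auto
      finally show "(\<Sum>x\<in>R - (G - ?B). marginal v ?A' x) + real s * marginal v ?A e
          \<le> real s * (\<tau> + v ?A')"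
        using less.prems(5) by (simp add: vA' algebra_simps)
      show "ds' \<in> set_pmf (sample_loop \<beta> s (G - ?B) (ds @ [(?B, e)]))" by (rule e(2))
    qed
  qed
qed


text \<open>For each \<open>l\<close> in \<open>D\<close>, \<open>v (P l \<inter> R) - v A\<close>
  is at most the sum of the marginals over \<open>P l \<inter> R\<close>. Summed over disjoint
  bundles this is at most the total marginal of \<open>R\<close>, hence at most
  \<open>s * (\<tau> + v A)\<close>. As \<open>s = k * card D\<close>, averaging over
  \<open>D\<close> gives the bound.\<close>

lemma sample_value:
  assumes val: "valuation m v" and sub: "submodular_on {1..m} v"
    and P: "P \<in> partitions n m" and D: "D \<subseteq> {1..n}" "card D = n - num_special h" "0 < card D"
    and "0 < k" "0 < c" and safe: "safe n m k c v \<sigma>"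
    and small: "\<And>e. e \<in> remaining m h \<Longrightarrow> v {e} < 1 / (c * real k)"
    and ds: "ds \<in> set_pmf (sample_loop (bucket \<sigma> h) (bucket_size n k h) (remaining m h) [])"
    and x: "x * real (card D) \<le> (\<Sum>l\<in>D. v (P l \<inter> remaining m h))"
  shows "x \<le> 1 / c + (real k + 1) * v (drawn ds)"
proof -
  let ?R = "remaining m h" and ?s = "bucket_size n k h" and ?\<tau> = "1 / (c * real k)"
  let ?A = "drawn ds"
  have R: "?R \<subseteq> {1..m}" by (auto simp: remaining_def)
  then have finR: "finite ?R" using finite_subset by blast
  have s: "?s = k * card D" "0 < ?s" using D \<open>0 < k\<close> by (auto simp: bucket_size_def)
  have v0: "0 \<le> v {}" using val by (auto simp: valuation_def)
  have A: "?A \<subseteq> {1..m} \<and> (\<Sum>e\<in>?R. marginal v ?A e) \<le> real ?s * (?\<tau> + v ?A)"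
  proof (rule sample_loop_safe[OF val sub R _ s(2) _ _ _ _ _ ds, where b = ?\<tau>])
    show "top_items (marginal v (drawn ds)) ?s (?R - (\<Union>B\<in>fst ` set ds. B)) (bucket \<sigma> h ds)"
      if "?s \<le> card (?R - (\<Union>B\<in>fst ` set ds. B))" for ds
      using safe small that unfolding safe_def unbucketed_def by (meson not_le)
    show "marginal v (drawn []) e \<le> ?\<tau>" if "e \<in> ?R" for e
      using small[OF that] v0 by (simp add: marginal_def drawn_def)
  qed (use v0 \<open>0 < c\<close> in \<open>auto simp: drawn_def distrib_left\<close>)
  have disj: "disjoint_family_on (\<lambda>l. P l \<inter> ?R) D"
    using P D(1) disjoint_family_on_mono[of D "{1..n}" P]
    by (auto simp: partitions_def disjoint_family_on_def)
  have finD: "finite D" using D(1) finite_subset by blast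
  have "v (P l \<inter> ?R) - v ?A \<le> (\<Sum>e\<in>P l \<inter> ?R. marginal v ?A e)" for l
  proof -
    have "v (P l \<inter> ?R) \<le> v (?A \<union> (P l \<inter> ?R))"
      using A R by (intro mono_valuation[OF val]) auto
    then show ?thesis
      using gain_le_sum_marginal[OF val sub, of ?A "P l \<inter> ?R"] A R by force
  qed
  then have "(\<Sum>l\<in>D. v (P l \<inter> ?R) - v ?A) \<le> (\<Sum>l\<in>D. \<Sum>e\<in>P l \<inter> ?R. marginal v ?A e)"
    by (rule sum_mono)
  also have "\<dots> = (\<Sum>e\<in>(\<Union>l\<in>D. P l \<inter> ?R). marginal v ?A e)"
    using disj finD finR by (subst sum.UNION_disjoint) (auto simp: disjoint_family_on_def)
  also have "\<dots> \<le> (\<Sum>e\<in>?R. marginal v ?A e)"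
    using finR A R marginal_nonneg[OF val] by (intro sum_mono2) auto
  also have "\<dots> \<le> real ?s * (?\<tau> + v ?A)" using A ..
  also have "\<dots> = real (card D) * (1 / c + real k * v ?A)"
    using \<open>0 < k\<close> by (simp add: s(1) field_simps)
  finally have "real (card D) * x \<le> real (card D) * (1 / c + (real k + 1) * v ?A)"
    using x by (simp add: sum_subtractf algebra_simps)
  then show ?thesis using D(3) by simp
qed

section \<open>Exponential moment of the sampled weight\<close>

text \<open>The left side is convex in \<open>x\<close> and the right side is its chord between 0
  and 1.\<close>

lemma powr_le_chord:
  fixes k x :: real
  assumes "0 \<le> k" "0 \<le> x" "x \<le> 1"
  shows "(1 + k) powr x \<le> 1 + k * x"
proof -
  have "exp ((1 - x) *\<^sub>R 0 + x *\<^sub>R ln (1 + k)) \<le> (1 - x) * exp 0 + x * exp (ln (1 + k))"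
    by (rule convex_onD[OF exp_convex]) (use assms in auto)
  then show ?thesis using assms by (simp add: powr_def algebra_simps)
qed

text \<open>By the chord bound, a uniform draw from \<open>B\<close> multiplies the moment by at
  most \<open>1 + k * sum w B / s\<close>, hence by at most \<open>exp (k * sum w B / s)\<close>.
  The buckets are disjoint, so the exponents add up to at most \<open>k * sum w G / s\<close>,
  whatever the bucket rule.\<close>

lemma sample_loop_powr:
  fixes w :: "nat \<Rightarrow> real" and k :: real
  assumes "\<And>e. 0 \<le> w e" "\<And>e. w e \<le> 1" "0 \<le> k" "finite G"
  shows "(\<integral>\<^sup>+ds'. ennreal ((1 + k) powr sum w (drawn ds')) \<partial>sample_loop \<beta> s G ds)
    \<le> ennreal ((1 + k) powr sum w (drawn ds) * exp (k * sum w G / real s))"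
  using \<open>finite G\<close>
proof (induction "card G" arbitrary: G ds rule: less_induct)
  case less
  let ?B = "\<beta> ds" and ?W = "(1 + k) powr sum w (drawn ds)"
  show ?case
  proof (cases "s \<le> card G \<and> 0 < s \<and> ?B \<subseteq> G \<and> card ?B = s")
    case False
    then have "sample_loop \<beta> s G ds = return_pmf ds" by (subst sample_loop.simps) (rule if_not_P[OF False])
    then show ?thesis
      using assms by (auto intro!: ennreal_leI mult_le_cancel_left1[THEN iffD2] mult_nonneg_nonneg
          divide_nonneg_nonneg sum_nonneg)
  next
    case True
    then have B: "?B \<subseteq> G" "card ?B = s" "0 < s" "finite ?B" "?B \<noteq> {}"
      using less.prems by (auto intro: finite_subset)
    let ?E = "exp (k * sum w (G - ?B) / real s)"
    have card_less: "card (G - ?B) < card G"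
      using B less.prems by (intro psubset_card_mono) auto
    have step: "(\<integral>\<^sup>+ds'. ennreal ((1 + k) powr sum w (drawn ds'))
          \<partial>sample_loop \<beta> s (G - ?B) (ds @ [(?B, e)])) \<le> ennreal (?W * ?E * (1 + k * w e))" for e
    proof -
      \<comment> \<open>Only an inequality, as \<open>ds\<close> is arbitrary and may already
        contain \<open>e\<close>.\<close>
      have "sum w (drawn (ds @ [(?B, e)])) \<le> sum w (drawn ds) + w e"
        using assms(1) sum.insert_if[of "drawn ds" w e] by (simp add: drawn_def)
      then have "(1 + k) powr sum w (drawn (ds @ [(?B, e)])) \<le> ?W * (1 + k) powr w e"
        using assms(3) by (simp add: powr_add[symmetric] powr_mono)
      also have "\<dots> \<le> ?W * (1 + k * w e)"
        using assms by (intro mult_left_mono powr_le_chord) auto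
      finally have "(1 + k) powr sum w (drawn (ds @ [(?B, e)])) * ?E \<le> ?W * (1 + k * w e) * ?E"
        by (rule mult_right_mono) simp
      then have "ennreal ((1 + k) powr sum w (drawn (ds @ [(?B, e)])) * ?E)
          \<le> ennreal (?W * ?E * (1 + k * w e))"
        by (intro ennreal_leI) (simp only: mult_ac)
      with less.hyps[OF card_less, of "ds @ [(?B, e)]"] less.prems show ?thesis
        by (meson finite_Diff order_trans)
    qed
    have "(\<integral>\<^sup>+ds'. ennreal ((1 + k) powr sum w (drawn ds')) \<partial>sample_loop \<beta> s G ds)
        = (\<integral>\<^sup>+e. \<integral>\<^sup>+ds'. ennreal ((1 + k) powr sum w (drawn ds'))
            \<partial>sample_loop \<beta> s (G - ?B) (ds @ [(?B, e)]) \<partial>pmf_of_set ?B)"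
      using True by (subst sample_loop.simps) (simp add: nn_integral_bind_pmf)
    also have "\<dots> \<le> (\<integral>\<^sup>+e. ennreal (?W * ?E * (1 + k * w e)) \<partial>pmf_of_set ?B)"
      by (intro nn_integral_mono step)
    also have "\<dots> = (\<Sum>e\<in>?B. ennreal (?W * ?E * (1 + k * w e))) / real s"
      using B by (simp add: nn_integral_pmf_of_set ennreal_of_nat_eq_real_of_nat)
    also have "\<dots> = ennreal (\<Sum>e\<in>?B. ?W * ?E * (1 + k * w e)) / ennreal (real s)"
      using assms by (subst sum_ennreal) (auto simp: ennreal_of_nat_eq_real_of_nat)
    also have "\<dots> = ennreal (?W * ?E * (1 + k * sum w ?B / real s))"
    proof -
      have "(\<Sum>e\<in>?B. ?W * ?E * (1 + k * w e)) = ?W * ?E * (real s + k * sum w ?B)"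
        using B by (simp add: sum_distrib_left[symmetric] sum.distrib)
      moreover have "\<dots> / real s = ?W * ?E * (1 + k * sum w ?B / real s)"
        using B by (simp add: field_simps)
      moreover have "0 \<le> (\<Sum>e\<in>?B. ?W * ?E * (1 + k * w e))"
        using assms by (intro sum_nonneg) auto
      ultimately show ?thesis using B by (simp add: divide_ennreal)
    qed
    also have "\<dots> \<le> ennreal (?W * ?E * exp (k * sum w ?B / real s))"
      by (intro ennreal_leI mult_left_mono exp_ge_add_one_self) auto
    also have "?W * ?E * exp (k * sum w ?B / real s) = ?W * exp (k * sum w G / real s)"
      using sum.subset_diff[OF B(1) less.prems, of w]
      by (simp add: exp_add[symmetric] algebra_simps add_divide_distrib)
    finally show ?thesis .
  qed
qed


section \<open>Bundles that survive the special rounds\<close>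

fun drop_bundle :: "(nat \<Rightarrow> nat set) \<Rightarrow> nat set \<Rightarrow> outcome \<Rightarrow> nat set" where
  "drop_bundle P D (Special e) = D - {SOME l. l \<in> D \<and> (e \<in> P l \<or> (\<forall>l'\<in>D. e \<notin> P l'))}"
| "drop_bundle P D (NonSpecial ds) = D"

text \<open>
  Every special round discards the bundle that it hits, or an arbitrary one if it hits
  none, so that the number of bundles kept is exactly the \<open>n - t\<close> of the bucket size.
\<close>

definition kept :: "nat \<Rightarrow> (nat \<Rightarrow> nat set) \<Rightarrow> history \<Rightarrow> nat set" where
  "kept n P h = foldl (drop_bundle P) {1..n} h"

text \<open>Disjointness ensures that \<open>e\<close> lies in at most one bundle; that one is
  discarded, so a special round takes nothing from the bundles that stay.\<close>

lemma drop_bundle_Special: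
  assumes "D \<noteq> {}" "disjoint_family_on P D"
  obtains l where "l \<in> D" "drop_bundle P D (Special e) = D - {l}" "\<forall>l'\<in>D - {l}. e \<notin> P l'"
proof -
  define l where "l = (SOME l. l \<in> D \<and> (e \<in> P l \<or> (\<forall>l'\<in>D. e \<notin> P l')))"
  have "\<exists>l. l \<in> D \<and> (e \<in> P l \<or> (\<forall>l'\<in>D. e \<notin> P l'))" using assms(1) by blast
  then have "l \<in> D \<and> (e \<in> P l \<or> (\<forall>l'\<in>D. e \<notin> P l'))" unfolding l_def by (rule someI_ex)
  moreover have "e \<notin> P l'" if "l' \<in> D - {l}" for l'
    using calculation disjoint_family_onD[OF assms(2), of l l'] that by auto
  moreover have "drop_bundle P D (Special e) = D - {l}" by (simp add: l_def)
  ultimately show ?thesis using that by blast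
qed

lemma kept_simps [simp]:
  "kept n P [] = {1..n}" "kept n P (h @ [r]) = drop_bundle P (kept n P h) r"
  by (simp_all add: kept_def)

lemma num_special_simps [simp]:
  "num_special [] = 0" "num_special (h @ [Special e]) = Suc (num_special h)"
  "num_special (h @ [NonSpecial ds]) = num_special h"
  by (simp_all add: num_special_def)

lemma num_special_le_length: "num_special h \<le> length h"
  by (simp add: num_special_def)

lemma remaining_snoc [simp]: "remaining m (h @ [r]) = remaining m h - received r"
  by (auto simp: remaining_def)

lemma finite_remaining [simp]: "finite (remaining m h)"
  by (simp add: remaining_def)

lemma kept_subset: "kept n P h \<subseteq> {1..n}"
proof (induction h rule: rev_induct)
  case (snoc r h)
  have "drop_bundle P D r \<subseteq> D" for D by (cases r) auto
  then show ?case unfolding kept_simps(2) using snoc by (rule subset_trans)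
qed simp

lemma finite_kept [simp]: "finite (kept n P h)"
  by (rule finite_subset[OF kept_subset]) simp

lemma card_kept:
  assumes "disjoint_family_on P {1..n}"
  shows "card (kept n P h) = n - num_special h"
proof (induction h rule: rev_induct)
  case (snoc r h)
  show ?case
  proof (cases r)
    case (Special e)
    show ?thesis
    proof (cases "kept n P h = {}")
      \<comment> \<open>Once no bundle is kept, the truncated subtraction
        \<open>n - num_special h\<close> stays at 0 too.\<close>
      case True
      then show ?thesis using snoc Special by simp
    next
      case False
      then obtain l where "l \<in> kept n P h" "drop_bundle P (kept n P h) (Special e) = kept n P h - {l}"
        using drop_bundle_Special disjoint_family_on_mono[OF kept_subset assms] by metis
      then show ?thesis using snoc Special by (simp del: drop_bundle.simps)
    qed
  qed (use snoc in simp)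
qed simp

section \<open>Outcomes of a safe round, and numerical bounds\<close>

text \<open>A special round is worth at least the threshold, so failure can only come from sampling,
  and then every remaining item is below the threshold.\<close>

lemma play_safe_cases:
  assumes "safe n m k c v \<sigma>" "r \<in> set_pmf (play n m k \<sigma> h)"
  obtains "1 / (c * real k) \<le> v (received r)"
  | ds where "received r = drawn ds"
    "ds \<in> set_pmf (sample_loop (bucket \<sigma> h) (bucket_size n k h) (remaining m h) [])"
    "\<And>e. e \<in> remaining m h \<Longrightarrow> v {e} < 1 / (c * real k)"
proof (cases "\<exists>e\<in>remaining m h. v {e} \<ge> 1 / (c * real k)")
  case True
  then obtain e where "e \<in> remaining m h" "choice \<sigma> h = Some e"
    "\<forall>e'\<in>remaining m h. v {e'} \<le> v {e}"
    using assms(1) unfolding safe_def by metis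
  then show ?thesis using True assms(2) that(1) by (force simp: play_def)
next
  case False
  then have "choice \<sigma> h = None" using assms(1) unfolding safe_def by metis
  then show ?thesis using False assms(2) that(2) by (auto simp: play_def not_le)
qed

lemma powr_five_eighths: "1577 / 577 \<le> (5::real) powr (5 / 8)"
  and exp_1_le_powr: "exp 1 \<le> (5::real) powr (5 / 8)"
proof -
  \<comment> \<open>Both bounds are checked on 8th powers (\<open>n = 7\<close> stands for the
    exponent \<open>Suc 7\<close>). The number 1577/577 is \<open>1 + 1 / 0.577\<close>.\<close>
  have eq: "((5::real) powr (5 / 8)) ^ 8 = 3125"
    by (simp add: powr_power powr_numeral)
  show "1577 / 577 \<le> (5::real) powr (5 / 8)"
    by (rule power_le_imp_le_base[where n = 7]) (simp_all add: eq power_divide)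
  have "exp 1 \<le> (272 / 100 :: real)" using e_less_272 by simp
  also have "\<dots> \<le> 5 powr (5 / 8)"
    by (rule power_le_imp_le_base[where n = 7]) (simp_all add: eq power_divide)
  finally show "exp 1 \<le> (5::real) powr (5 / 8)" .
qed

lemma length_run: "h \<in> set_pmf (run n m k \<sigma> i) \<Longrightarrow> length h = i"
  by (induction i arbitrary: h) auto

section \<open>The supermartingale\<close>

text \<open>The potential is built from the partition and its weights alone; a valuation enters only
  when a failed round is turned into a large potential.\<close>

locale weighted_bundles =
  fixes n m :: nat and P :: "nat \<Rightarrow> nat set" and w :: "nat \<Rightarrow> real"
  assumes partition: "P \<in> partitions n m"
    and weight_nonneg: "\<And>l e. l \<in> {1..n} \<Longrightarrow> e \<in> P l \<Longrightarrow> 0 \<le> w e"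
    and weight_bundle: "\<And>l. l \<in> {1..n} \<Longrightarrow> sum w (P l) = 1"
begin

lemma disjoint_bundles: "disjoint_family_on P {1..n}"
  using partition by (auto simp: partitions_def)

lemma finite_bundle:
  assumes "l \<in> {1..n}"
  shows "finite (P l)"
proof -
  have "P l \<subseteq> {1..m}" using partition assms by (auto simp: partitions_def)
  then show ?thesis using finite_subset by blast
qed

lemma weight_le_1:
  assumes "l \<in> {1..n}" "e \<in> P l"
  shows "w e \<le> 1"
  using member_le_sum[OF assms(2) _ finite_bundle[OF assms(1)], of w] weight_nonneg weight_bundle assms
  by auto

lemma weight_inter_le_1:
  assumes "l \<in> {1..n}"
  shows "sum w (P l \<inter> R) \<le> 1"
  using sum_mono2[of "P l" "P l \<inter> R" w] finite_bundle weight_nonneg weight_bundle assms by auto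

definition kept_weight :: "history \<Rightarrow> real" where
  "kept_weight h = (\<Sum>l\<in>kept n P h. sum w (P l \<inter> remaining m h))"

text \<open>The exponent of \<open>1 + k\<close> is the weight deficit, that of \<open>exp\<close>
  minus the number of non-special rounds. The base \<open>1 + k\<close> makes the expected growth in
  a sampling round at most \<open>exp 1\<close>.\<close>

definition potential :: "real \<Rightarrow> history \<Rightarrow> real" where
  "potential k h = (1 + k) powr (real (card (kept n P h)) - kept_weight h)
     * exp (- (real (length h) - real (num_special h)))"

text \<open>The number of kept bundles drops by 1 and the kept weight by at most 1, since only the
  discarded bundle loses weight. The number of non-special rounds is unchanged.\<close>

lemma potential_Special:
  assumes "kept n P h \<noteq> {}" "0 \<le> k"
  shows "potential k (h @ [Special e]) \<le> potential k h"
proof -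
  let ?D = "kept n P h"
  obtain l where l: "l \<in> ?D" "drop_bundle P ?D (Special e) = ?D - {l}" "\<forall>l'\<in>?D - {l}. e \<notin> P l'"
    using drop_bundle_Special[OF assms(1) disjoint_family_on_mono[OF kept_subset disjoint_bundles]]
    by metis
  have "kept_weight (h @ [Special e]) = (\<Sum>l'\<in>?D - {l}. sum w (P l' \<inter> remaining m h))"
    using l by (auto simp: kept_weight_def simp del: drop_bundle.simps intro!: sum.cong arg_cong[of _ _ "sum w"])
  also have "\<dots> = kept_weight h - sum w (P l \<inter> remaining m h)"
    using l(1) by (simp add: kept_weight_def sum_diff1)
  also have "\<dots> \<ge> kept_weight h - 1"
    using weight_inter_le_1[of l] l(1) kept_subset[of n P h] by auto
  finally have W: "kept_weight h - 1 \<le> kept_weight (h @ [Special e])" .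
  have "real (card (kept n P (h @ [Special e]))) = real (card ?D) - 1"
    using l by (simp del: drop_bundle.simps add: of_nat_diff Suc_leI card_gt_0_iff assms(1))
  then show ?thesis
    using W assms unfolding potential_def by (auto intro!: mult_mono powr_mono)
qed

text \<open>Each kept bundle has remaining weight at most 1, so the kept weight is at most
  \<open>n - t\<close>. With bucket size \<open>k * (n - t)\<close> the moment bound is at most
  \<open>exp 1\<close>, which the additional factor \<open>exp (- 1)\<close> cancels.\<close>

lemma potential_sample_loop:
  assumes "kept n P h \<noteq> {}" "0 < k"
  shows "(\<integral>\<^sup>+ds. ennreal (potential (real k) (h @ [NonSpecial ds]))
      \<partial>sample_loop \<beta> (bucket_size n k h) (remaining m h) []) \<le> ennreal (potential k h)"
proof -
  let ?D = "kept n P h" and ?R = "remaining m h"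
  define U where "U = (\<Union>l\<in>?D. P l)"
  \<comment> \<open>Extension by zero outside the kept bundles: draws there cost nothing, and the
    weights lie in [0,1] everywhere, as \<open>sample_loop_powr\<close> requires.\<close>
  define w' where "w' e = (if e \<in> U then w e else 0)" for e
  have D: "l \<in> {1..n}" if "l \<in> ?D" for l using that kept_subset by blast
  have w': "0 \<le> w' e" "w' e \<le> 1" for e
    using weight_nonneg weight_le_1 D unfolding w'_def U_def by (auto, blast+)
  have kept_sum: "(\<Sum>l\<in>?D. sum w (P l \<inter> S)) = sum w' S" if "finite S" for S
  proof -
    have "(\<Sum>l\<in>?D. sum w (P l \<inter> S)) = sum w (\<Union>l\<in>?D. P l \<inter> S)"
    proof (rule sum.UNION_disjoint[symmetric])
      have "P l \<inter> P l' = {}" if "l \<in> ?D" "l' \<in> ?D" "l \<noteq> l'" for l l'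
        using disjoint_family_onD[OF disjoint_bundles] D that by blast
      then show "\<forall>l\<in>?D. \<forall>l'\<in>?D. l \<noteq> l' \<longrightarrow> (P l \<inter> S) \<inter> (P l' \<inter> S) = {}" by blast
    qed (use that in auto)
    also have "(\<Union>l\<in>?D. P l \<inter> S) = S \<inter> U" by (auto simp: U_def)
    also have "sum w (S \<inter> U) = sum w' S"
      using that by (simp add: w'_def sum.inter_restrict)
    finally show ?thesis .
  qed
  have kw: "kept_weight h = sum w' ?R" using kept_sum[of ?R] by (simp add: kept_weight_def)
  have kw_le: "kept_weight h \<le> real (card ?D)"
    using sum_bounded_above[of ?D "\<lambda>l. sum w (P l \<inter> ?R)" 1] weight_inter_le_1 D
    by (simp add: kept_weight_def)
  have loss: "kept_weight h - sum w' (drawn ds) \<le> kept_weight (h @ [NonSpecial ds])" for ds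
  proof -
    have "sum w' ?R - sum w' (drawn ds) \<le> sum w' (?R - drawn ds)"
    proof -
      have "sum w' ?R \<le> sum w' ((?R - drawn ds) \<union> drawn ds)"
        using w' by (intro sum_mono2) (auto simp: drawn_def)
      also have "\<dots> = sum w' (?R - drawn ds) + sum w' (drawn ds)"
        by (intro sum.union_disjoint) (auto simp: drawn_def)
      finally show ?thesis by simp
    qed
    then show ?thesis using kept_sum[of "?R - drawn ds"] by (simp add: kw) (simp add: kept_weight_def)
  qed
  let ?c = "potential k h * exp (- 1)"
  have c_nonneg: "0 \<le> ?c" by (simp add: potential_def)
  have "potential (real k) (h @ [NonSpecial ds]) \<le> ?c * (1 + real k) powr (sum w' (drawn ds))" for ds
  proof -
    have *: "(1 + real k) powr (real (card ?D) - kept_weight (h @ [NonSpecial ds]))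
        \<le> (1 + real k) powr (real (card ?D) - kept_weight h) * (1 + real k) powr (sum w' (drawn ds))"
      unfolding powr_add[symmetric] using loss[of ds] by (intro powr_mono) auto
    have exponent: "- (real (length (h @ [NonSpecial ds])) - real (num_special (h @ [NonSpecial ds])))
        = - (real (length h) - real (num_special h)) + - 1"
      by simp
    show ?thesis
      using mult_right_mono[OF *, of "exp (- (real (length h) - real (num_special h))) * exp (- 1)"]
      unfolding potential_def exponent exp_add by (simp only: mult_ac kept_simps drop_bundle.simps) simp
  qed
  then have "(\<integral>\<^sup>+ds. ennreal (potential (real k) (h @ [NonSpecial ds]))
      \<partial>sample_loop \<beta> (bucket_size n k h) ?R [])
    \<le> (\<integral>\<^sup>+ds. ennreal ?c * ennreal ((1 + real k) powr sum w' (drawn ds))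
      \<partial>sample_loop \<beta> (bucket_size n k h) ?R [])"
    by (intro nn_integral_mono) (simp only: ennreal_mult'[symmetric] c_nonneg powr_ge_zero ennreal_leI)
  also have "\<dots> = ennreal ?c * (\<integral>\<^sup>+ds. ennreal ((1 + real k) powr sum w' (drawn ds))
      \<partial>sample_loop \<beta> (bucket_size n k h) ?R [])"
    by (rule nn_integral_cmult) simp
  also have "\<dots> \<le> ennreal ?c * ennreal ((1 + real k) powr sum w' (drawn [])
      * exp (real k * sum w' ?R / real (bucket_size n k h)))"
    using w' by (intro mult_left_mono sample_loop_powr) auto
  also have "\<dots> \<le> ennreal ?c * ennreal (exp 1)"
  proof (intro mult_left_mono ennreal_leI)
    have "0 < card ?D" using assms(1) by (simp add: card_gt_0_iff)
    then have "real k * sum w' ?R / real (bucket_size n k h) \<le> 1"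
      using kw_le \<open>0 < k\<close> unfolding kw bucket_size_def card_kept[OF disjoint_bundles, symmetric]
      by (simp add: field_simps)
    then show "(1 + real k) powr sum w' (drawn [])
        * exp (real k * sum w' ?R / real (bucket_size n k h)) \<le> exp 1"
      by (simp add: drawn_def)
  qed simp
  also have "\<dots> = ennreal (potential k h)"
    using c_nonneg by (simp add: ennreal_mult'[symmetric] mult.assoc mult_exp_exp)
  finally show ?thesis .
qed

text \<open>Fewer than \<open>n\<close> rounds cannot have discarded all \<open>n\<close> bundles,
  so one of the two preceding bounds applies, whatever the strategy.\<close>

lemma potential_play:
  assumes "length h < n" "0 < k"
  shows "(\<integral>\<^sup>+r. ennreal (potential (real k) (h @ [r])) \<partial>play n m k \<sigma> h) \<le> ennreal (potential k h)"
proof -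
  have "0 < card (kept n P h)"
    using num_special_le_length[of h] assms(1) by (simp add: card_kept[OF disjoint_bundles])
  then have "kept n P h \<noteq> {}" by auto
  then show ?thesis
    using potential_Special[of h "real k"] potential_sample_loop[of h k] assms(2)
    by (auto simp: play_def ennreal_leI split: option.split)
qed

lemma potential_run:
  assumes "i \<le> n" "0 < k"
  shows "(\<integral>\<^sup>+h. ennreal (potential (real k) h) \<partial>run n m k \<sigma> i) \<le> 1"
  using assms(1)
proof (induction i)
  case 0
  \<comment> \<open>Initially all \<open>n\<close> bundles are whole, so the deficit is 0 and the
    potential is 1.\<close>
  have "kept_weight [] = real n"
  proof -
    have "P l \<inter> remaining m [] = P l" if "l \<in> {1..n}" for l
      using partition that by (auto simp: partitions_def remaining_def)
    then show ?thesis by (simp add: kept_weight_def weight_bundle)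
  qed
  then show ?case by (simp add: potential_def)
next
  case (Suc i)
  have "(\<integral>\<^sup>+h. ennreal (potential (real k) h) \<partial>run n m k \<sigma> (Suc i))
      = (\<integral>\<^sup>+h. \<integral>\<^sup>+r. ennreal (potential (real k) (h @ [r])) \<partial>play n m k (\<sigma> (Suc i)) h \<partial>run n m k \<sigma> i)"
    by simp
  also have "\<dots> \<le> (\<integral>\<^sup>+h. ennreal (potential (real k) h) \<partial>run n m k \<sigma> i)"
    using Suc.prems assms(2) length_run[of _ n m k \<sigma> i]
    by (intro nn_integral_mono_AE) (auto simp: AE_measure_pmf_iff intro!: potential_play)
  also have "\<dots> \<le> 1" using Suc by simp
  finally show ?case .
qed

text \<open>Failure forces a deficit above \<open>5/8 * (n - t)\<close> by contraposition of
  \<open>sample_value\<close>. Here \<open>n - t\<close> counts the agents still to act, the current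
  one included, plus the past non-special rounds; each of the latter gives a factor
  \<open>5 powr (5/8)\<close> that outweighs its \<open>exp (- 1)\<close>.\<close>

lemma failed_round_potential:
  assumes val: "valuation m v" and sub: "submodular_on {1..m} v"
    and below: "\<And>l S. l \<in> {1..n} \<Longrightarrow> S \<subseteq> P l \<Longrightarrow> sum w S \<le> v S"
    and safe: "safe n m 4 6 v \<sigma>" and len: "length h < n"
    and r: "r \<in> set_pmf (play n m 4 \<sigma> h)" and fail: "v (received r) < 1 / 24"
  shows "(5 powr (5 / 8)) ^ (n - length h) \<le> potential 4 h"
proof -
  let ?D = "kept n P h" and ?N = "length h - num_special h"
  obtain ds where ds: "received r = drawn ds"
      "ds \<in> set_pmf (sample_loop (bucket \<sigma> h) (bucket_size n 4 h) (remaining m h) [])"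
    and small: "\<And>e. e \<in> remaining m h \<Longrightarrow> v {e} < 1 / (6 * real 4)"
    using play_safe_cases[OF safe r] fail by auto
  have card: "card ?D = n - num_special h" by (rule card_kept[OF disjoint_bundles])
  have t: "num_special h \<le> length h" by (rule num_special_le_length)
  have bundle_le: "sum w (P l \<inter> remaining m h) \<le> v (P l \<inter> remaining m h)" if "l \<in> ?D" for l
    using that kept_subset[of n P h] by (intro below[of l]) auto
  have "kept_weight h < 3 / 8 * real (card ?D)"
  proof (rule ccontr)
    assume "\<not> ?thesis"
    then have "3 / 8 * real (card ?D) \<le> kept_weight h" by simp
    also have "\<dots> \<le> (\<Sum>l\<in>?D. v (P l \<inter> remaining m h))"
      unfolding kept_weight_def by (rule sum_mono) (rule bundle_le)
    finally have "3 / 8 * real (card ?D) \<le> (\<Sum>l\<in>?D. v (P l \<inter> remaining m h))" .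
    \<comment> \<open>For \<open>c = 6\<close> and \<open>k = 4\<close> this yields a value of at
      least \<open>(3/8 - 1/6) / 5 = 1/24\<close>.\<close>
    then have "3 / 8 \<le> 1 / 6 + (real 4 + 1) * v (drawn ds)"
      using card t len small
      by (intro sample_value[OF val sub partition kept_subset card _ _ _ safe _ ds(2)]) auto
    then show False using fail ds(1) by simp
  qed
  then have "5 powr (5 / 8 * real (card ?D)) \<le> 5 powr (real (card ?D) - kept_weight h)"
    by (intro powr_mono) auto
  then have "(5 powr (5 / 8)) ^ card ?D \<le> 5 powr (real (card ?D) - kept_weight h)"
    by (simp only: powr_power simp_thms) simp
  from mult_right_mono[OF this, of "exp (- real ?N)"]
  have "(5 powr (5 / 8)) ^ card ?D * exp (- real ?N) \<le> potential 4 h"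
    using t by (simp add: potential_def of_nat_diff)
  moreover have "card ?D = n - length h + ?N" using card t len by simp
  moreover have "exp (real ?N) \<le> (5 powr (5 / 8)) ^ ?N"
    using power_mono[OF exp_1_le_powr, of ?N] by (simp add: exp_of_nat_mult[symmetric])
  then have "1 \<le> (5 powr (5 / 8)) ^ ?N * exp (- real ?N)"
    by (simp add: exp_minus field_simps)
  then have "(5 powr (5 / 8)) ^ (n - length h) * 1
      \<le> (5 powr (5 / 8)) ^ (n - length h) * ((5 powr (5 / 8)) ^ ?N * exp (- real ?N))"
    by (intro mult_left_mono) auto
  ultimately show ?thesis by (simp only: power_add mult.assoc mult_1_right)
qed

end

section \<open>Failure probabilities and their sum\<close>

text \<open>Later rounds only append to the history and integrate out. Index \<open>i\<close> counts
  from 0, so it belongs to agent \<open>Suc i\<close>.\<close>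

lemma map_nth_run:
  assumes "i < j"
  shows "map_pmf (\<lambda>h. h ! i) (run n m k \<sigma> j) = run n m k \<sigma> i \<bind> play n m k (\<sigma> (Suc i))"
  using assms
proof (induction j)
  case (Suc j)
  have "map_pmf (\<lambda>h. h ! i) (run n m k \<sigma> (Suc j))
      = run n m k \<sigma> j \<bind> (\<lambda>h. play n m k (\<sigma> (Suc j)) h \<bind> (\<lambda>r. return_pmf ((h @ [r]) ! i)))"
    by (simp add: map_bind_pmf)
  also have "\<dots> = run n m k \<sigma> i \<bind> play n m k (\<sigma> (Suc i))"
  proof (cases "i = j")
    case True
    then show ?thesis
      by (intro bind_pmf_cong) (auto dest: length_run simp: nth_append bind_return_pmf')
  next
    case False
    then have "i < j" using Suc.prems by simp
    then have "run n m k \<sigma> j \<bind> (\<lambda>h. play n m k (\<sigma> (Suc j)) h \<bind> (\<lambda>r. return_pmf ((h @ [r]) ! i)))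
      = run n m k \<sigma> j \<bind> (\<lambda>h. return_pmf (h ! i))"
      by (intro bind_pmf_cong) (auto dest: length_run simp: nth_append bind_pmf_const)
    then show ?thesis using Suc.IH \<open>i < j\<close> by (simp add: map_pmf_def)
  qed
  finally show ?case .
qed simp

text \<open>Markov's inequality for the potential before agent \<open>i\<close> acts, whose mean is
  at most 1. Then \<open>i - 1\<close> rounds are over, hence the exponent
  \<open>n + 1 - i\<close>.\<close>

lemma failure_probability:
  assumes val: "valuation m v" and sub: "submodular_on {1..m} v" and MMS: "1 \<le> MMS n m v"
    and i: "i \<in> {1..n}" and safe: "safe n m 4 6 v (\<sigma> i)"
  shows "measure_pmf.prob (single_or_sample n m 4 \<sigma>) {h. 1 / 24 \<le> v (allocation h i)}
    \<ge> 1 - (1 / 5 powr (5 / 8)) ^ (n + 1 - i)"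
proof -
  define K where "K = (5 powr (5 / 8) :: real) ^ (n + 1 - i)"
  have K: "0 < K" by (simp add: K_def)
  define F where "F = {r. v (received r) < 1 / 24}"
  let ?p = "run n m 4 \<sigma> (i - 1) \<bind> play n m 4 (\<sigma> i)"
  have Suc_i: "Suc (i - 1) = i" using i by simp
  have "emeasure ?p F \<le> ennreal (1 / K)"
  \<comment> \<open>Normalized weights require \<open>v {} < 1\<close>; the other case is settled
    directly.\<close>
  proof (cases "v {} < 1")
    case True
    obtain P where P: "P \<in> partitions n m" "\<And>l. l \<in> {1..n} \<Longrightarrow> MMS n m v \<le> v (P l)"
      using MMS_witness[of n m v] i by auto
    have "1 \<le> v (P l)" if "l \<in> {1..n}" for l using P(2)[OF that] MMS by simp
    then obtain w where w: "\<And>l e. l \<in> {1..n} \<Longrightarrow> e \<in> P l \<Longrightarrow> 0 \<le> w e"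
      "\<And>l. l \<in> {1..n} \<Longrightarrow> sum w (P l) = 1"
      "\<And>l S. l \<in> {1..n} \<Longrightarrow> S \<subseteq> P l \<Longrightarrow> sum w S \<le> v S"
      using bundle_weights[OF val sub P(1) True] by blast
    interpret weighted_bundles n m P w
      using P(1) w(1,2) by unfold_locales auto
    \<comment> \<open>Markov pointwise: if failure is possible after \<open>h\<close>, the potential
      is at least \<open>K\<close> and the right side at least 1.\<close>
    have bound: "emeasure (play n m 4 (\<sigma> i) h) F \<le> ennreal (1 / K) * ennreal (potential 4 h)"
      if h: "h \<in> set_pmf (run n m 4 \<sigma> (i - 1))" for h
    proof (cases "set_pmf (play n m 4 (\<sigma> i) h) \<inter> F = {}")
      case True
      then show ?thesis
        by (metis measure_pmf.emeasure_eq_measure measure_pmf_zero_iff ennreal_0 zero_le)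
    next
      case False
      then obtain r where r: "r \<in> set_pmf (play n m 4 (\<sigma> i) h)" "v (received r) < 1 / 24"
        by (auto simp: F_def)
      have len: "length h < n" "n - length h = n + 1 - i" using length_run[OF h] i by auto
      have "K \<le> potential 4 h"
        using failed_round_potential[OF val sub w(3) safe len(1) r] len(2) by (simp add: K_def)
      then have "1 \<le> 1 / K * potential 4 h" using K by (simp add: field_simps)
      then have "1 \<le> ennreal (1 / K * potential 4 h)" by simp
      then have "1 \<le> ennreal (1 / K) * ennreal (potential 4 h)"
        using K by (subst ennreal_mult'[symmetric]) auto
      then show ?thesis using measure_pmf.emeasure_le_1 order_trans by blast
    qed
    have "emeasure ?p F = (\<integral>\<^sup>+h. emeasure (play n m 4 (\<sigma> i) h) F \<partial>run n m 4 \<sigma> (i - 1))"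
      by (rule emeasure_bind_pmf)
    also have "\<dots> \<le> (\<integral>\<^sup>+h. ennreal (1 / K) * ennreal (potential 4 h) \<partial>run n m 4 \<sigma> (i - 1))"
      by (intro nn_integral_mono_AE) (auto simp: AE_measure_pmf_iff intro!: bound)
    also have "\<dots> = ennreal (1 / K) * (\<integral>\<^sup>+h. ennreal (potential 4 h) \<partial>run n m 4 \<sigma> (i - 1))"
      by (rule nn_integral_cmult) simp
    also have "\<dots> \<le> ennreal (1 / K) * 1"
      using potential_run[of "i - 1" 4 \<sigma>] i by (intro mult_left_mono) auto
    finally show ?thesis by simp
  next
    case False
    then have v_empty: "1 \<le> v {}" by simp
    have "v (received r) \<ge> 1 / 24" if r: "r \<in> set_pmf (play n m 4 (\<sigma> i) h)"
      and "length h < n" for r h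
    proof (rule ccontr)
      assume low: "\<not> ?thesis"
      then obtain ds where ds: "received r = drawn ds"
        "ds \<in> set_pmf (sample_loop (bucket (\<sigma> i) h) (bucket_size n 4 h) (remaining m h) [])"
        and small: "\<And>e. e \<in> remaining m h \<Longrightarrow> v {e} < 1 / (6 * real 4)"
        using play_safe_cases[OF safe r] by auto
      \<comment> \<open>Any remaining item would trigger a special round, so sampling occurs only
        with nothing left. It then draws nothing, and \<open>v {}\<close> already suffices.\<close>
      have "1 \<le> v {e}" if "e \<in> remaining m h" for e
        using that v_empty mono_valuation[OF val, of "{}" "{e}"] by (auto simp: remaining_def)
      then have "remaining m h = {}" using small by fastforce
      moreover have "0 < bucket_size n 4 h"
        using num_special_le_length[of h] \<open>length h < n\<close> by (simp add: bucket_size_def)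
      ultimately have "ds = []" using ds(2) by (subst (asm) sample_loop.simps) simp
      then show False using low v_empty ds(1) by (simp add: drawn_def)
    qed
    then have "set_pmf ?p \<inter> F = {}"
      using i by (fastforce simp: F_def dest: length_run)
    then have "emeasure ?p F = 0"
      by (simp add: measure_pmf.emeasure_eq_measure measure_pmf_zero_iff)
    then show ?thesis by simp
  qed
  then have fail: "measure_pmf.prob ?p F \<le> 1 / K"
    using K by (simp add: measure_pmf.emeasure_eq_measure)
  have p: "?p = map_pmf (\<lambda>h. h ! (i - 1)) (single_or_sample n m 4 \<sigma>)"
    using map_nth_run[of "i - 1" n n m 4 \<sigma>] i unfolding single_or_sample_def Suc_i by auto
  have "{h. 1 / 24 \<le> v (allocation h i)} = (\<lambda>h. h ! (i - 1)) -` (- F)"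
    by (auto simp: allocation_def F_def)
  then have "measure_pmf.prob (single_or_sample n m 4 \<sigma>) {h. 1 / 24 \<le> v (allocation h i)}
      = measure_pmf.prob ?p (- F)"
    by (simp only: p measure_map_pmf)
  also have "\<dots> = 1 - measure_pmf.prob ?p F"
    using measure_pmf.prob_compl[of F ?p] by (simp add: Compl_eq_Diff_UNIV)
  finally show ?thesis using fail by (simp add: K_def power_one_over)
qed

theorem theorem5p1:
  fixes n m :: nat and v :: "nat \<Rightarrow> nat set \<Rightarrow> real"
  assumes "\<And>i. i \<in> {1..n} \<Longrightarrow> valuation m (v i)"
    and "\<And>i. i \<in> {1..n} \<Longrightarrow> MMS n m (v i) = 1"
  shows "\<exists>(c::real) (k::nat) (q::nat \<Rightarrow> real).
    c > 0 \<and> k \<ge> 1 \<and> (\<forall>i\<in>{1..n}. 0 \<le> q i \<and> q i \<le> 1) \<and>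
    (\<forall>i\<in>{1..n}. submodular_on {1..m} (v i) \<longrightarrow>
      (\<forall>\<sigma>::nat \<Rightarrow> strategy.
        safe n m k c (v i) (\<sigma> i) \<longrightarrow>
        (\<forall>j\<in>{1..n} - {i}. legal n m k (\<sigma> j)) \<longrightarrow>
        measure_pmf.prob (single_or_sample n m k \<sigma>)
          {h. v i (allocation h i) \<ge> 1/24 * MMS n m (v i)} \<ge> 1 - q i)) \<and>
    (\<Sum>i\<in>{1..n}. q i) \<le> 0.577"
proof -
  define x :: real where "x = 1 / 5 powr (5 / 8)"
  have x: "0 < x" "x \<le> 577 / 1577"
    using powr_five_eighths by (auto simp: x_def field_simps)
  have "(\<Sum>i\<in>{1..n}. x ^ (n + 1 - i)) = (\<Sum>i\<in>{1..n}. x ^ i)"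
    by (subst sum.atLeastAtMost_rev) (simp add: Suc_diff_le)
  also have "\<dots> \<le> x / (1 - x)"
  proof -
    have "(\<Sum>i\<in>{1..n}. x ^ i) = (x - x ^ Suc n) / (1 - x)"
      using x by (subst sum_gp) auto
    then show ?thesis using x by (simp add: divide_right_mono)
  qed
  \<comment> \<open>At \<open>x = 577/1577\<close> the quotient \<open>x / (1 - x)\<close> is
    exactly 577/1000.\<close>
  also have "\<dots> \<le> 0.577" using x by (simp add: field_simps)
  finally have total: "(\<Sum>i\<in>{1..n}. x ^ (n + 1 - i)) \<le> 0.577" .
  have unit: "0 \<le> x ^ j \<and> x ^ j \<le> 1" for j using x by (simp add: power_le_one)
  have "1 - x ^ (n + 1 - i) \<le> measure_pmf.prob (single_or_sample n m 4 \<sigma>)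
      {h. v i (allocation h i) \<ge> 1/24 * MMS n m (v i)}"
    if "i \<in> {1..n}" "submodular_on {1..m} (v i)" "safe n m 4 6 (v i) (\<sigma> i)" for i \<sigma>
    using failure_probability[where \<sigma> = \<sigma>, OF assms(1)[OF that(1)] that(2) _ that(1,3)] assms(2)[OF that(1)]
    by (simp add: x_def)
  then show ?thesis
    using unit total
    by (intro exI[of _ 6] exI[of _ 4] exI[of _ "\<lambda>i. x ^ (n + 1 - i)"]) simp
qed

end
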